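(* Let $p,q\ge 1$ be integers of the same parity. Then $$|NC_2(p,q)|=\sum_{a=1}^{\min\{p,q\}} a\binom{p}{\frac{p-a}{2}}\binom{q}{\frac{q-a}{2}},$$ where summands with $\frac{p-a}{2}$ (equivalently $\frac{q-a}{2}$) not an integer are $0$.
   Context: $NC_2(p,q)$ denotes the set of non-crossing annular pair partitions: place $1,\dots,p$ clockwise on the inner circle and $p+1,\dots,p+q$ counterclockwise on the concentric outer circle of an annulus; $NC_2(p,q)$ is the set of pair partitions $\pi$ of $[p+q]=\{1,\dots,p+q\}$ whose pairs can be drawn as non-crossing curves inside the annulus and such that at least one pair connects the two circles. Equivalently, identifying a pair partition with the permutation of $[p+q]$ whose cycles are its pairs, $\pi\in NC_2(p,q)$ iff at least one pair of $\pi$ contains one element of $\{1,\dots,p\}$ and one element of $\{p+1,\dots,p+q\}$, and $\#(\pi)+\#(\pi^{-1}\rho)=p+q$, where $\rho=(1,2,\dots,p)(p+1,\dots,p+q)$ and $\#(\cdot)$ is the number of cycles (fixed points included). Convention: $\binom{n}{x}=0$ if $x$ is not an integer. *)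

theory Defs
  imports Complex_Main "HOL-Library.Disjoint_Sets" "HOL-Combinatorics.Cycles" "HOL-Combinatorics.Orbits"
begin

definition pair_partition_on :: "'a set \<Rightarrow> 'a set set \<Rightarrow> bool" where
  "pair_partition_on A P \<longleftrightarrow> partition_on A P \<and> (\<forall>B\<in>P. card B = 2)"

(* The permutation whose cycles on the underlying set are the pairs of P; it is the
   identity elsewhere. *)
definition pair_perm :: "'a set set \<Rightarrow> 'a \<Rightarrow> 'a" where
  "pair_perm P x = (if x \<in> \<Union>P then (THE y. y \<noteq> x \<and> {x, y} \<in> P) else x)"

(* Number of cycles on A of a permutation f of A. Since orbit f x = {x} for a fixed
   point x, fixed points are counted. *)
definition num_cycles :: "'a set \<Rightarrow> ('a \<Rightarrow> 'a) \<Rightarrow> nat" where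
  "num_cycles A f = card (orbit f ` A)"

(* rho = (1, ..., p)(p+1, ..., p+q) *)
definition annular_perm :: "nat \<Rightarrow> nat \<Rightarrow> nat \<Rightarrow> nat" where
  "annular_perm p q = cycle_of_list [1..<p+1] \<circ> cycle_of_list [p+1..<p+q+1]"

(* Non-crossing annular pair partitions, with 1, ..., p placed clockwise on the inner and
   p+1, ..., p+q counterclockwise on the outer circle. Planarity of the annular diagram is
   expressed by the genus-zero (Euler characteristic) condition on the numbers of cycles. *)
definition NC2 :: "nat \<Rightarrow> nat \<Rightarrow> nat set set set" where
  "NC2 p q = {P. pair_partition_on {1..p+q} P
      \<and> (\<exists>i\<in>{1..p}. \<exists>j\<in>{p+1..p+q}. {i, j} \<in> P)
      \<and> num_cycles {1..p+q} (pair_perm P)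
          + num_cycles {1..p+q} (inv (pair_perm P) \<circ> annular_perm p q) = p + q}"

(* Binomial coefficient with the convention that it vanishes unless x is a (natural) integer. *)
definition binom :: "nat \<Rightarrow> real \<Rightarrow> nat" where
  "binom n x = (if x \<in> \<nat> then n choose nat \<lfloor>x\<rfloor> else 0)"

lemma pair_perm_eq:
  assumes "pair_partition_on A P" "{x, y} \<in> P" "x \<noteq> y"
  shows "pair_perm P x = y"
proof -
  have "(THE z. z \<noteq> x \<and> {x, z} \<in> P) = y"
  proof (rule the_equality)
    fix z assume z: "z \<noteq> x \<and> {x, z} \<in> P"
    then have "{x, z} \<inter> {x, y} \<noteq> {}" "{x, z} \<in> P" by auto
    then have "{x, z} = {x, y}"
      using assms(1,2) unfolding pair_partition_on_def partition_on_def
      by (metis disjointD)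
    then show "z = y" using z by (auto simp: doubleton_eq_iff)
  qed (use assms in auto)
  then show ?thesis using assms unfolding pair_perm_def by auto
qed

lemma orbit_pair_perm:
  assumes "pair_partition_on A P" "B \<in> P" "x \<in> B"
  shows "orbit (pair_perm P) x = B"
proof -
  have "card B = 2" using assms by (auto simp: pair_partition_on_def)
  then obtain y where y: "B = {x, y}" "x \<noteq> y"
    using assms(3) by (auto simp: card_2_iff)
  have xy: "pair_perm P x = y" and yx: "pair_perm P y = x"
    using assms y pair_perm_eq[of A P x y] pair_perm_eq[of A P y x]
    by (auto simp: insert_commute)
  have "z \<in> B" if "z \<in> orbit (pair_perm P) x" for z
    using that by induction (auto simp: y xy yx)
  moreover have "y \<in> orbit (pair_perm P) x" "x \<in> orbit (pair_perm P) x"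
    using orbit.base[of "pair_perm P" x] orbit.step[of y "pair_perm P" x] by (auto simp: xy yx)
  ultimately show ?thesis using y by auto
qed

lemma cycles_pair_perm:
  assumes "pair_partition_on A P"
  shows "orbit (pair_perm P) ` A = P"
proof -
  have A: "A = \<Union>P" and ne: "{} \<notin> P"
    using assms by (auto simp: pair_partition_on_def partition_on_def)
  show ?thesis
  proof (intro equalityI subsetI)
    fix B assume "B \<in> orbit (pair_perm P) ` A"
    then obtain x where x: "x \<in> A" "B = orbit (pair_perm P) x" by blast
    then obtain C where C: "C \<in> P" "x \<in> C" using A by blast
    then show "B \<in> P" using orbit_pair_perm[OF assms C] x(2) by simp
  next
    fix B assume B: "B \<in> P"
    then obtain x where x: "x \<in> B" using ne by fastforce
    then have "x \<in> A" using A B by blast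
    then show "B \<in> orbit (pair_perm P) ` A"
      using orbit_pair_perm[OF assms B x] by (intro image_eqI) auto
  qed
qed

end

theory Submission
  imports Defs
begin

text \<open>A half-diagram with \<open>a > 0\<close> through strings on one circle is determined by the places where its
  arcs open, which form an arbitrary subset of size \<open>(p - a) / 2\<close>; the through strings of two such
  half-diagrams can be joined by \<open>a\<close> rotations. Instead of constructing this bijection, we count both
  sides by the same recursion. Let \<open>E\<close> be a set of points \<open>x\<close> at which the adjacent pair
  \<open>{x, \<rho> x}\<close> is forbidden. Adding a point to \<open>E\<close> loses exactly the diagrams that contain
  this pair, and deleting the pair from them, with its two points skipped in \<open>\<rho>\<close>, gives a smaller
  instance of genus zero. Once every adjacent pair is forbidden, \<open>\<pi>\<rho>\<close> has no fixed points
  but half as many cycles as points, so it is an involution: \<open>\<pi>\<close> conjugates \<open>\<rho>\<close> to its inverse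
  and exchanges the two circles, which is possible in \<open>p\<close> ways if \<open>p = q\<close> and impossible
  otherwise. On the other side only the empty set of openers is then left.\<close>

section \<open>Skipping a point of a permutation\<close>

text \<open>Composing with a transposition takes \<open>y\<close> out of its cycle: for injective
  \<open>f\<close>, \<open>y\<close> becomes a fixed point and its preimage is sent on to
  \<open>f y\<close>. No change of type or restriction of the domain is involved.\<close>

definition skip :: "'a \<Rightarrow> ('a \<Rightarrow> 'a) \<Rightarrow> 'a \<Rightarrow> 'a" where
  "skip y f = transpose y (f y) \<circ> f"

lemma skip_apply:
  assumes "inj f"
  shows "skip y f u = (if u = y then y else if f u = y then f y else f u)"
  using injD[OF assms, of u y] by (auto simp: skip_def transpose_def)

lemma skip_permutes:
  assumes "f permutes A" "y \<in> A"
  shows "skip y f permutes A - {y}"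
proof -
  have "f y \<in> A"
    using assms by (simp add: permutes_in_image)
  then have "skip y f permutes A"
    unfolding skip_def using assms by (intro permutes_compose permutes_swap_id)
  moreover have "skip y f y = y"
    by (simp add: skip_def)
  ultimately show ?thesis
    unfolding permutes_def by auto
qed

text \<open>Both walks from \<open>u\<close> visit the same points in the same order, except that
  the new one jumps over \<open>y\<close>.\<close>

lemma orbit_skip:
  assumes "inj f" "u \<noteq> y"
  shows "orbit (skip y f) u = orbit f u - {y}"
proof (intro equalityI subsetI)
  note skip = skip_apply[OF assms(1), of y]
  fix v assume "v \<in> orbit (skip y f) u"
  then show "v \<in> orbit f u - {y}"
  proof induction
    case base
    then show ?case
      using assms injD[OF assms(1), of u y] orbit.base[of f u] orbit.step[of "f u" f u]
      by (auto simp: skip)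
  next
    case (step v)
    then show ?case
      using assms injD[OF assms(1), of v y] orbit.step[of v f u] orbit.step[of "f v" f u]
      by (auto simp: skip)
  qed
next
  note skip = skip_apply[OF assms(1), of y]
  fix v assume v: "v \<in> orbit f u - {y}"
  then have "v \<in> orbit f u" by simp
  \<comment> \<open>The new walk never reaches \<open>y\<close>; the invariant at \<open>y\<close>
    is that it has already reached the next point \<open>f y\<close>.\<close>
  then have "if v = y then f y \<in> orbit (skip y f) u else v \<in> orbit (skip y f) u"
  proof induction
    case base
    show ?case
      using orbit.base[of "skip y f" u] assms(2) by (auto simp: skip[of u] split: if_splits)
  next
    case (step v)
    show ?case
    proof (cases "v = y")
      case True
      then show ?thesis using step.IH by auto
    next
      case False
      then have "skip y f v \<in> orbit (skip y f) u"
        using step.IH by (auto intro: orbit.step)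
      then show ?thesis using False by (auto simp: skip[of v] split: if_splits)
    qed
  qed
  then show "v \<in> orbit (skip y f) u" using v by simp
qed

lemma orbit_eqI_permutes:
  assumes "f permutes A" "finite A" "z \<in> orbit f u" "z \<in> orbit f v"
  shows "orbit f u = orbit f v"
  using assms by (metis cyclic_on_orbit orbit_cyclic_eq3)

text \<open>Since \<open>f y \<noteq> y\<close>, the cycle of \<open>y\<close> keeps a point after
  \<open>y\<close> is deleted, so deleting \<open>y\<close> from each cycle neither destroys nor
  merges cycles.\<close>

lemma num_cycles_skip:
  assumes f: "f permutes A" "finite A" and y: "y \<in> A" "f y \<noteq> y"
  shows "num_cycles (A - {y}) (skip y f) = num_cycles A f"
proof -
  have inj: "inj f" using f by (simp add: permutes_inj)
  have perm: "permutation f" using f permutation_permutes by blast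
  have "orbit f y = orbit f (f y)"
    using perm by (simp add: permutation_orbit_step)
  moreover have "f y \<in> A - {y}"
    using f y by (simp add: permutes_in_image)
  ultimately have A: "orbit f ` A = orbit f ` (A - {y})"
    by (metis image_insert insert_Diff insert_absorb y(1))
  have "orbit (skip y f) ` (A - {y}) = (\<lambda>Q. Q - {y}) ` orbit f ` (A - {y})"
    unfolding image_image by (intro image_cong) (auto simp: orbit_skip[OF inj])
  moreover have "inj_on (\<lambda>Q. Q - {y}) (orbit f ` (A - {y}))"
  proof (rule inj_onI, elim imageE)
    fix Q R u v
    assume QR: "Q - {y} = R - {y}" "Q = orbit f u" "R = orbit f v" and uv: "u \<in> A - {y}"
    have "u \<in> orbit f u" by (rule permutation_self_in_orbit[OF perm])
    then have "u \<in> orbit f v" using QR uv by auto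
    then show "Q = R"
      using QR orbit_eqI_permutes[OF f] \<open>u \<in> orbit f u\<close> by blast
  qed
  ultimately show ?thesis
    unfolding num_cycles_def A by (simp add: card_image)
qed

lemma num_cycles_fixed_point:
  assumes f: "f permutes A" "finite A" and x: "x \<in> A" "f x = x"
  shows "num_cycles A f = Suc (num_cycles (A - {x}) f)"
proof -
  have "orbit f x = {x}" using x by (simp add: orbit_eq_singleton_iff)
  moreover have "{x} \<notin> orbit f ` (A - {x})"
  proof (rule notI, elim imageE)
    fix u assume u: "u \<in> A - {x}" "{x} = orbit f u"
    have "u \<in> orbit f u"
      using f permutation_permutes by (intro permutation_self_in_orbit) blast
    then show False using u by auto
  qed
  moreover have "orbit f ` A = insert (orbit f x) (orbit f ` (A - {x}))"
    using x by auto
  ultimately show ?thesis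
    unfolding num_cycles_def using f by simp
qed

section \<open>Pair partitions as involutions\<close>

lemma finite_pair_partition:
  assumes "pair_partition_on A P" "finite A"
  shows "finite P"
  using assms by (auto simp: pair_partition_on_def partition_on_def intro: finite_UnionD)

lemma pair_perm_block:
  assumes P: "pair_partition_on A P" and u: "u \<in> A"
  shows "{u, pair_perm P u} \<in> P" "pair_perm P u \<noteq> u"
proof -
  obtain Q where Q: "Q \<in> P" "u \<in> Q"
    using P u by (auto simp: pair_partition_on_def partition_on_def)
  moreover have "card Q = 2"
    using P Q by (auto simp: pair_partition_on_def)
  ultimately obtain v where v: "Q = {u, v}" "u \<noteq> v"
    by (auto simp: card_2_iff)
  then have "pair_perm P u = v"
    using pair_perm_eq[OF P] Q by blast
  then show "{u, pair_perm P u} \<in> P" "pair_perm P u \<noteq> u"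
    using Q v by auto
qed

lemma pair_block_iff:
  assumes P: "pair_partition_on A P"
  shows "{u, v} \<in> P \<longleftrightarrow> u \<in> A \<and> pair_perm P u = v"
proof
  assume uv: "{u, v} \<in> P"
  then have "card {u, v} = 2" "u \<in> A"
    using P by (auto simp: pair_partition_on_def partition_on_def)
  then have "u \<noteq> v" by auto
  then show "u \<in> A \<and> pair_perm P u = v"
    using pair_perm_eq[OF P uv] \<open>u \<in> A\<close> by simp
next
  assume "u \<in> A \<and> pair_perm P u = v"
  then show "{u, v} \<in> P" using pair_perm_block(1)[OF P] by blast
qed

lemma pair_perm_outside:
  assumes "pair_partition_on A P" "u \<notin> A"
  shows "pair_perm P u = u"
  using assms by (auto simp: pair_perm_def pair_partition_on_def partition_on_def)

lemma pair_perm_involution: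
  assumes P: "pair_partition_on A P"
  shows "pair_perm P (pair_perm P u) = u"
proof (cases "u \<in> A")
  case True
  then have "{pair_perm P u, u} \<in> P"
    using pair_perm_block(1)[OF P] by (simp add: insert_commute)
  then show ?thesis
    using pair_block_iff[OF P] by blast
qed (simp add: pair_perm_outside[OF P])

lemma pair_perm_permutes:
  assumes P: "pair_partition_on A P"
  shows "pair_perm P permutes A"
  unfolding permutes_def
proof (intro conjI allI impI ex1I)
  fix u v
  show "pair_perm P (pair_perm P v) = v"
    by (rule pair_perm_involution[OF P])
  show "u = pair_perm P v" if "pair_perm P u = v"
    using pair_perm_involution[OF P, of u] that by simp
qed (rule pair_perm_outside[OF P])

lemma pair_perm_in:
  assumes "pair_partition_on A P"
  shows "pair_perm P u \<in> A \<longleftrightarrow> u \<in> A"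
  using permutes_in_image[OF pair_perm_permutes[OF assms]] .

lemma inv_pair_perm:
  assumes "pair_partition_on A P"
  shows "inv (pair_perm P) = pair_perm P"
  using pair_perm_involution[OF assms] by (intro inv_equality) auto

lemma pair_partition_eqI:
  assumes P: "pair_partition_on A P" and Q: "pair_partition_on A Q"
    and eq: "\<And>u. u \<in> A \<Longrightarrow> pair_perm P u = pair_perm Q u"
  shows "P = Q"
proof -
  have "orbit (pair_perm P) = orbit (pair_perm Q)"
    using eq pair_perm_outside[OF P] pair_perm_outside[OF Q] by (intro arg_cong[where f = orbit] ext) metis
  then show ?thesis
    using cycles_pair_perm[OF P] cycles_pair_perm[OF Q] by metis
qed

text \<open>The conjunct \<open>{x, y} \<notin> P\<close> rules out an insertion that changes
  nothing, so that inserting and deleting the pair are mutually inverse.\<close>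

lemma pair_partition_insert_iff:
  assumes "x \<in> A" "y \<in> A" "x \<noteq> y"
  shows "pair_partition_on A (insert {x, y} P) \<and> {x, y} \<notin> P \<longleftrightarrow> pair_partition_on (A - {x, y}) P"
proof
  assume P: "pair_partition_on A (insert {x, y} P) \<and> {x, y} \<notin> P"
  then have "partition_on A (insert {x, y} P)" by (simp add: pair_partition_on_def)
  then have "A = {x, y} \<union> \<Union>P" "disjoint (insert {x, y} P)" "{} \<notin> P"
    by (auto simp: partition_on_def)
  moreover have "disjnt {x, y} (\<Union>P)"
    using calculation P by (fastforce simp: disjoint_def pairwise_def disjnt_def)
  ultimately show "pair_partition_on (A - {x, y}) P"
    using P by (auto simp: pair_partition_on_def partition_on_def disjnt_def disjoint_def)
next
  assume P: "pair_partition_on (A - {x, y}) P"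
  then have "\<Union>P = A - {x, y}" by (simp add: pair_partition_on_def partition_on_def)
  then have "{x, y} \<notin> P" "\<And>Q. Q \<in> P \<Longrightarrow> Q \<inter> {x, y} = {}" "insert x (insert y A) = A"
    using assms by auto
  then show "pair_partition_on A (insert {x, y} P) \<and> {x, y} \<notin> P"
    using P assms by (simp add: pair_partition_on_def partition_on_def disjoint_def Int_commute)
qed

lemma pair_perm_insert:
  assumes xy: "x \<in> A" "y \<in> A" "x \<noteq> y" and P: "pair_partition_on (A - {x, y}) P"
  shows "pair_perm (insert {x, y} P) = (pair_perm P)(x := y, y := x)"
proof
  have Q: "pair_partition_on A (insert {x, y} P)"
    using pair_partition_insert_iff[OF xy] P by blast
  fix u
  show "pair_perm (insert {x, y} P) u = ((pair_perm P)(x := y, y := x)) u"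
  proof (cases "u \<in> A")
    case True
    then have "{u, ((pair_perm P)(x := y, y := x)) u} \<in> insert {x, y} P"
      using pair_perm_block(1)[OF P, of u] by auto
    then show ?thesis using pair_block_iff[OF Q] by metis
  next
    case False
    then show ?thesis
      using pair_perm_outside[OF Q] pair_perm_outside[OF P] xy by auto
  qed
qed

text \<open>The pair sends \<open>y\<close> back to \<open>x\<close>, so \<open>x\<close> is a fixed
  point of the composition and contributes one cycle. Skipping \<open>y\<close> in what remains
  leaves the composition for \<open>P\<close>; as \<open>r y \<noteq> x\<close>, \<open>y\<close> is
  not fixed and this costs no cycle.\<close>

lemma num_cycles_pair_perm_insert:
  assumes r: "r permutes A" and A: "finite A" and x: "x \<in> A" "r x = y" "x \<noteq> y" "r y \<noteq> x"
    and P: "pair_partition_on (A - {x, y}) P"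
  shows "num_cycles A (pair_perm (insert {x, y} P) \<circ> r)
    = Suc (num_cycles (A - {x, y}) (pair_perm P \<circ> skip y (skip x r)))"
proof -
  have y: "y \<in> A" using r x by (metis permutes_in_image)
  have inj: "inj r" "inj (skip x r)"
    using r skip_permutes[OF r x(1)] by (auto simp: permutes_inj)
  define f where "f = pair_perm (insert {x, y} P) \<circ> r"
  have perm: "pair_perm (insert {x, y} P) = (pair_perm P)(x := y, y := x)"
    using x y P by (intro pair_perm_insert)
  have Q: "pair_partition_on A (insert {x, y} P)"
    using pair_partition_insert_iff[OF x(1) y x(3)] P by blast
  have f: "f permutes A"
    unfolding f_def using r pair_perm_permutes[OF Q] by (rule permutes_compose)
  have fx: "f x = x" using x by (simp add: f_def perm)
  then have fA: "f permutes A - {x}"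
    using f x by (auto simp: permutes_def)
  have f_apply: "f v = (if r v = x then y else if r v = y then x else pair_perm P (r v))" for v
    using x by (simp add: f_def perm)
  have ry: "r y \<noteq> y" using x inj by (metis injD)
  have "pair_perm P (r y) \<noteq> y"
    using pair_perm_in[OF P, of "r y"] r ry x y by (auto simp: permutes_in_image)
  then have fy: "f y \<noteq> y"
    using x ry by (auto simp: f_def perm)
  have "skip y f u = (pair_perm P \<circ> skip y (skip x r)) u" for u
  proof -
    have P1: "pair_perm P v = y \<longleftrightarrow> v = y" "pair_perm P v = x \<longleftrightarrow> v = x" for v
      using pair_perm_involution[OF P] pair_perm_outside[OF P, of y] pair_perm_outside[OF P, of x]
      by (metis Diff_iff insertCI)+
    have inj': "r v = r w \<Longrightarrow> v = w" for v w
      using inj by (meson injD)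
    have f: "skip y f u = (if u = y then y else if f u = y then f y else f u)"
      using f by (simp add: skip_apply permutes_inj)
    have r: "skip y (skip x r) u = (if u = y then y else if u = x then x
        else if r u = x then r y else r u)"
      using x inj' by (simp add: skip_apply inj)
    have u: "r u = x \<Longrightarrow> u \<noteq> x \<and> u \<noteq> y" "r u = y \<longleftrightarrow> u = x"
      using x inj' by auto
    \<comment> \<open>The essential case is \<open>r u = x\<close>: there \<open>f u = y\<close>, so
      skipping \<open>y\<close> leads on to \<open>f y = pair_perm P (r y)\<close>, while skipping
      \<open>x\<close> and \<open>y\<close> in \<open>r\<close> sends \<open>u\<close> to
      \<open>r y\<close>.\<close>
    consider "u = y" | "u = x" | "r u = x" | "u \<noteq> y" "u \<noteq> x" "r u \<noteq> x" by blast
    then show ?thesis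
      unfolding comp_apply f r by cases (use x u ry in \<open>simp_all add: f_apply P1 pair_perm_outside[OF P]\<close>)
  qed
  then have "skip y f = pair_perm P \<circ> skip y (skip x r)" by (rule ext)
  moreover have "num_cycles A f = Suc (num_cycles (A - {x}) f)"
    using num_cycles_fixed_point[OF f A x(1) fx] .
  moreover have "num_cycles (A - {x}) f = num_cycles (A - {x} - {y}) (skip y f)"
    using num_cycles_skip[OF fA _ _ fy] A y x(3) by simp
  moreover have "A - {x} - {y} = A - {x, y}" by auto
  ultimately show ?thesis by (simp add: f_def)
qed

text \<open>Every cycle has at least two points, so there are at most half as many cycles as points,
  with equality exactly when all cycles are transpositions.\<close>

lemma num_cycles_no_fixed_points:
  assumes f: "f permutes A" "finite A" and nofix: "\<And>u. u \<in> A \<Longrightarrow> f u \<noteq> u"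
  shows "2 * num_cycles A f = card A \<longleftrightarrow> (\<forall>u\<in>A. f (f u) = u)"
proof -
  have perm: "permutation f" using f permutation_permutes by blast
  have ge2: "2 \<le> card Q" if "Q \<in> orbit f ` A" for Q
  proof -
    from that obtain u where u: "u \<in> A" "Q = orbit f u" by blast
    have "{u, f u} \<subseteq> Q" "finite Q"
      using u permutation_self_in_orbit[OF perm, of u] finite_orbit[of u f] by (auto intro: orbit.base)
    moreover have "card {u, f u} = 2" using nofix[OF u(1)] by simp
    ultimately show ?thesis by (metis card_mono)
  qed
  have "\<Union>(orbit f ` A) = A"
    using permutes_orbit_subset[OF f(1)] permutation_self_in_orbit[OF perm] by fastforce
  moreover have "disjoint (orbit f ` A)"
    using orbit_eqI_permutes[OF f] unfolding disjoint_def by blast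
  ultimately have card: "card A = (\<Sum>Q\<in>orbit f ` A. card Q)"
    using card_Union_disjoint[of "orbit f ` A"] finite_orbit[OF permutation_self_in_orbit[OF perm]]
    by auto
  show ?thesis
  proof
    assume "2 * num_cycles A f = card A"
    then have eq: "(\<Sum>Q\<in>orbit f ` A. 2) = (\<Sum>Q\<in>orbit f ` A. card Q)"
      unfolding card by (simp add: num_cycles_def)
    show "\<forall>u\<in>A. f (f u) = u"
    proof
      fix u assume u: "u \<in> A"
      have "2 = card (orbit f u)"
        \<comment> \<open>Equal sums with \<open>2 \<le> card Q\<close> for every cycle force
          equality for each cycle.\<close>
        using sum_mono_inv[OF eq ge2, of "orbit f u"] u f by auto
      moreover have "{u, f u} \<subseteq> orbit f u" "finite (orbit f u)"
        using u permutation_self_in_orbit[OF perm, of u] finite_orbit[of u f] by (auto intro: orbit.base)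
      moreover have "card {u, f u} = 2" using nofix[OF u] by (metis card_2_iff)
      ultimately have "orbit f u = {u, f u}" by (metis card_subset_eq)
      then have "f (f u) = u \<or> f (f u) = f u"
        by (metis insertE orbit.base orbit.step singletonD)
      then show "f (f u) = u"
        using nofix[of "f u"] u f by (auto simp: permutes_in_image)
    qed
  next
    assume inv: "\<forall>u\<in>A. f (f u) = u"
    have "card Q = 2" if "Q \<in> orbit f ` A" for Q
    proof -
      from that obtain u where u: "u \<in> A" "Q = orbit f u" by blast
      have "v \<in> {u, f u}" if "v \<in> orbit f u" for v
        using that by induction (use inv u in \<open>auto simp: u\<close>)
      then have "Q \<subseteq> {u, f u}" using u by blast
      then have "card Q \<le> card {u, f u}" by (intro card_mono) auto
      also have "\<dots> = 2" using nofix[OF u(1)] by simp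
      finally show ?thesis using ge2[OF that] by simp
    qed
    then show "2 * num_cycles A f = card A"
      unfolding card by (simp add: num_cycles_def)
  qed
qed

lemma card_pair_partition:
  assumes P: "pair_partition_on A P" "finite A"
  shows "2 * card P = card A"
  using num_cycles_no_fixed_points[OF pair_perm_permutes[OF P(1)] P(2) pair_perm_block(2)[OF P(1)]]
    pair_perm_involution[OF P(1)] cycles_pair_perm[OF P(1)]
  by (simp add: num_cycles_def)

section \<open>Planar pairings and opener sets of a permutation with two cycles\<close>

text \<open>The annulus in abstract form: \<open>B\<close> and \<open>C\<close> are the circles and
  \<open>r\<close> steps along both. Arbitrary sets replace intervals because the recursion deletes
  points; \<open>cyclic_on\<close> makes both circles finite and nonempty.\<close>

locale two_cycles =
  fixes B C :: "'a set" and r :: "'a \<Rightarrow> 'a"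
  assumes disj: "B \<inter> C = {}"
    and perm: "r permutes B \<union> C"
    and cyclic: "cyclic_on r B" "cyclic_on r C"
begin

text \<open>Transfers facts proved for one circle to the other.\<close>

lemma swap: "two_cycles C B r"
  using disj perm cyclic by unfold_locales (auto simp: Un_commute)

lemma finite: "finite B" "finite C" "finite (B \<union> C)"
  using cyclic by (auto simp: finite_cyclic_on)

lemma nonempty: "B \<noteq> {}" "C \<noteq> {}"
  using cyclic by (auto simp: cyclic_on_alldef)

lemma inj: "inj r"
  using perm by (rule permutes_inj)

lemma step_in: "r x \<in> B \<longleftrightarrow> x \<in> B" "r x \<in> C \<longleftrightarrow> x \<in> C"
  using cyclic cyclic_on_inI cyclic_on_f_in[OF perm] by metis+

text \<open>Otherwise \<open>{x, r x}\<close> would be a whole cycle, hence one of the two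
  circles.\<close>

lemma step_twice:
  assumes "x \<in> B \<union> C" "B - {x, r x} \<noteq> {}" "C - {x, r x} \<noteq> {}"
  shows "r (r x) \<noteq> x"
proof
  assume rr: "r (r x) = x"
  have "v \<in> {x, r x}" if "v \<in> orbit r x" for v
    using that by induction (auto simp: rr)
  then show False
    using assms orbit_cyclic_eq3[OF cyclic(1), of x] orbit_cyclic_eq3[OF cyclic(2), of x] by blast
qed

lemma skip_step:
  assumes x: "x \<in> B \<union> C" "r x \<noteq> x" and ne: "B - {x, r x} \<noteq> {}" "C - {x, r x} \<noteq> {}"
  shows "two_cycles (B - {x, r x}) (C - {x, r x}) (skip (r x) (skip x r))"
proof
  show "(B - {x, r x}) \<inter> (C - {x, r x}) = {}" using disj by blast
  have skip: "skip x r permutes B \<union> C - {x}"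
    using perm x by (intro skip_permutes)
  moreover have "r x \<in> B \<union> C - {x}" using x step_in by blast
  ultimately have "skip (r x) (skip x r) permutes B \<union> C - {x} - {r x}"
    by (rule skip_permutes)
  moreover have "B \<union> C - {x} - {r x} = B - {x, r x} \<union> (C - {x, r x})" by blast
  ultimately show "skip (r x) (skip x r) permutes B - {x, r x} \<union> (C - {x, r x})" by simp
  have "cyclic_on (skip (r x) (skip x r)) (D - {x, r x})" if D: "cyclic_on r D" "D - {x, r x} \<noteq> {}" for D
  proof -
    obtain u where u: "u \<in> D - {x, r x}" using D by blast
    then have "orbit r u = D" using D by (intro orbit_cyclic_eq3) auto
    then have "orbit (skip (r x) (skip x r)) u = D - {x, r x}"
      using u orbit_skip[OF permutes_inj[OF skip], of u "r x"] orbit_skip[OF inj, of u x] by auto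
    then show ?thesis using u by (intro cyclic_on_singleI[of u]) auto
  qed
  then show "cyclic_on (skip (r x) (skip x r)) (B - {x, r x})"
    "cyclic_on (skip (r x) (skip x r)) (C - {x, r x})"
    using cyclic ne by blast+
qed

lemma skip_step_apply:
  assumes "x \<in> B \<union> C" "r x \<noteq> x" "u \<noteq> x" "u \<noteq> r x" "r u \<noteq> x"
  shows "skip (r x) (skip x r) u = r u"
proof -
  have "inj (skip x r)"
    using skip_permutes[OF perm assms(1)] by (rule permutes_inj)
  moreover have "r u \<noteq> r x" using assms inj by (metis injD)
  ultimately show ?thesis using assms by (simp add: skip_apply inj)
qed

end

definition planar_pairings :: "'a set \<Rightarrow> 'a set \<Rightarrow> ('a \<Rightarrow> 'a) \<Rightarrow> 'a set \<Rightarrow> 'a set set set" where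
  "planar_pairings B C r E = {P. pair_partition_on (B \<union> C) P
      \<and> (\<exists>i\<in>B. \<exists>j\<in>C. {i, j} \<in> P)
      \<and> card P + num_cycles (B \<union> C) (pair_perm P \<circ> r) = card (B \<union> C)
      \<and> (\<forall>x\<in>E. {x, r x} \<notin> P)}"

text \<open>A set \<open>S\<close> is read as a word that opens an arc at the points of \<open>S\<close> and, elsewhere, closes one
  or emits a through string; so \<open>E\<close> forbids the same adjacent arcs as in \<open>planar_pairings\<close>. The
  weight is the number of through strings on either circle, which is also the number of rotations
  by which they can be joined.\<close>

definition opener_sets :: "'a set \<Rightarrow> 'a set \<Rightarrow> ('a \<Rightarrow> 'a) \<Rightarrow> 'a set \<Rightarrow> 'a set set" where
  "opener_sets B C r E = {S. S \<subseteq> B \<union> C \<and> (\<forall>x\<in>E. x \<in> S \<longrightarrow> r x \<in> S)}"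

definition weight :: "'a set \<Rightarrow> 'a set \<Rightarrow> 'a set \<Rightarrow> nat" where
  "weight B C S = (if card B + 2 * card (S \<inter> C) = card C + 2 * card (S \<inter> B)
    then card B - 2 * card (S \<inter> B) else 0)"

context two_cycles
begin

lemma finite_planar_pairings: "finite (planar_pairings B C r E)"
proof (rule finite_subset)
  show "planar_pairings B C r E \<subseteq> Pow (Pow (B \<union> C))"
    by (auto simp: planar_pairings_def pair_partition_on_def partition_on_def)
qed (simp add: finite)

lemma finite_opener_sets: "finite (opener_sets B C r E)"
  using finite by (auto simp: opener_sets_def intro: finite_subset[of _ "Pow (B \<union> C)"])

lemma planar_pairings_split:
  "card (planar_pairings B C r E)
    = card (planar_pairings B C r (insert x E)) + card {P \<in> planar_pairings B C r E. {x, r x} \<in> P}"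
proof -
  have "planar_pairings B C r E
    = planar_pairings B C r (insert x E) \<union> {P \<in> planar_pairings B C r E. {x, r x} \<in> P}"
    by (auto simp: planar_pairings_def)
  moreover have "planar_pairings B C r (insert x E) \<inter> {P \<in> planar_pairings B C r E. {x, r x} \<in> P} = {}"
    by (auto simp: planar_pairings_def)
  ultimately show ?thesis
    using card_Un_disjoint finite_planar_pairings by (metis finite_Un)
qed

text \<open>The sets lost when \<open>x\<close> joins \<open>E\<close> are the words with an arc
  that opens at \<open>x\<close> and closes at once at \<open>r x\<close>.\<close>

lemma opener_sets_split:
  "sum (weight B C) (opener_sets B C r E)
    = sum (weight B C) (opener_sets B C r (insert x E))
      + sum (weight B C) {S \<in> opener_sets B C r E. x \<in> S \<and> r x \<notin> S}"
proof -
  have "opener_sets B C r E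
    = opener_sets B C r (insert x E) \<union> {S \<in> opener_sets B C r E. x \<in> S \<and> r x \<notin> S}"
    by (auto simp: opener_sets_def)
  then have "sum (weight B C) (opener_sets B C r E) = sum (weight B C)
      (opener_sets B C r (insert x E) \<union> {S \<in> opener_sets B C r E. x \<in> S \<and> r x \<notin> S})"
    by (rule arg_cong)
  also have "\<dots> = sum (weight B C) (opener_sets B C r (insert x E))
      + sum (weight B C) {S \<in> opener_sets B C r E. x \<in> S \<and> r x \<notin> S}"
    by (rule sum.union_disjoint) (auto simp: finite_opener_sets, auto simp: opener_sets_def)
  finally show ?thesis .
qed

text \<open>A pair joining the circles is disjoint from \<open>{x, r x}\<close>, which lies on a
  single circle; its two ends thus show that neither circle is exhausted by \<open>x\<close> and
  \<open>r x\<close>.\<close>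

lemma planar_pairings_degenerate:
  assumes "x \<in> B \<union> C" "r x = x \<or> B - {x, r x} = {} \<or> C - {x, r x} = {}"
  shows "{P \<in> planar_pairings B C r E. {x, r x} \<in> P} = {}"
proof (safe, goal_cases)
  case (1 P)
  then have P: "pair_partition_on (B \<union> C) P" "\<exists>i\<in>B. \<exists>j\<in>C. {i, j} \<in> P"
    by (auto simp: planar_pairings_def)
  then obtain i j where ij: "i \<in> B" "j \<in> C" "pair_perm P i = j" "pair_perm P j = i"
    using pair_block_iff[OF P(1)] by (metis insert_commute)
  have x: "pair_perm P x = r x" "pair_perm P (r x) = x" "r x \<noteq> x"
    using 1 pair_block_iff[OF P(1)] pair_perm_block[OF P(1) assms(1)] by (metis insert_commute)+
  have "i \<noteq> x" "i \<noteq> r x" "j \<noteq> x" "j \<noteq> r x"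
    using ij x(1,2) disj step_in[of x] by (metis disjoint_iff)+
  then show ?case using ij x(3) assms(2) by blast
qed

text \<open>If a circle is just \<open>{x, r x}\<close>, exactly half of it opens, so it has no
  through strings; the weight demands equal numbers on both circles and is therefore 0. If
  \<open>r x = x\<close>, no such \<open>S\<close> exists.\<close>

lemma opener_sets_degenerate:
  assumes "x \<in> B \<union> C" "r x = x \<or> B - {x, r x} = {} \<or> C - {x, r x} = {}"
  shows "sum (weight B C) {S \<in> opener_sets B C r E. x \<in> S \<and> r x \<notin> S} = 0"
proof (intro sum.neutral ballI)
  fix S assume S: "S \<in> {S \<in> opener_sets B C r E. x \<in> S \<and> r x \<notin> S}"
  then have ne: "r x \<noteq> x" by auto
  have *: "2 * card (S \<inter> D) = card D" if "D \<subseteq> {x, r x}" "x \<in> D" "r x \<in> D" for D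
  proof -
    have "D = {x, r x}" "S \<inter> D = {x}" using that S by auto
    then show ?thesis using ne by simp
  qed
  have "2 * card (S \<inter> B) = card B \<or> 2 * card (S \<inter> C) = card C"
    using assms *[of B] *[of C] ne step_in nonempty by blast
  then show "weight B C S = 0" by (auto simp: weight_def)
qed

text \<open>Deleting the pair is a bijection and keeps genus zero, as one pair, one cycle and two
  points disappear. The preimage of \<open>x\<close> leaves \<open>E\<close>: its old adjacent pair
  contains \<open>x\<close>, which is already taken, and its new adjacent pair, across the gap, was
  never forbidden.\<close>

lemma planar_pairings_remove:
  assumes x: "x \<in> B \<union> C" "r x \<noteq> x" "x \<notin> E"
    and ne: "B - {x, r x} \<noteq> {}" "C - {x, r x} \<noteq> {}"
  shows "card {P \<in> planar_pairings B C r E. {x, r x} \<in> P}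
    = card (planar_pairings (B - {x, r x}) (C - {x, r x}) (skip (r x) (skip x r))
        {u \<in> E. u \<noteq> r x \<and> r u \<noteq> x})"
    (is "card ?L = card ?R")
proof -
  define y where "y = r x"
  have y: "y \<in> B \<longleftrightarrow> x \<in> B" "y \<in> C \<longleftrightarrow> x \<in> C" "y \<in> B \<union> C" "x \<noteq> y" "r y \<noteq> x"
    using x step_in[of x] step_twice[OF x(1) ne] by (auto simp: y_def)
  have A: "B - {x, y} \<union> (C - {x, y}) = B \<union> C - {x, y}" by blast
  note insert_iff = pair_partition_insert_iff[OF x(1) y(3,4)]
  have iff: "insert {x, y} P \<in> ?L \<longleftrightarrow> P \<in> ?R" if P: "pair_partition_on (B \<union> C - {x, y}) P" for P
  proof -
    have Q: "pair_partition_on (B \<union> C) (insert {x, y} P)" "{x, y} \<notin> P"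
      using P insert_iff by auto
    have sub: "\<Union>P = B \<union> C - {x, y}"
      using P by (simp add: pair_partition_on_def partition_on_def)
    have "(\<exists>i\<in>B. \<exists>j\<in>C. {i, j} \<in> insert {x, y} P) \<longleftrightarrow> (\<exists>i\<in>B - {x, y}. \<exists>j\<in>C - {x, y}. {i, j} \<in> P)"
    proof -
      have "{i, j} \<noteq> {x, y}" if "i \<in> B" "j \<in> C" for i j
        using that y disj by (auto simp: doubleton_eq_iff)
      moreover have "i \<notin> {x, y} \<and> j \<notin> {x, y}" if "{i, j} \<in> P" for i j
        using that sub by auto
      ultimately show ?thesis by blast
    qed
    moreover have "card (insert {x, y} P) + num_cycles (B \<union> C) (pair_perm (insert {x, y} P) \<circ> r) = card (B \<union> C)
      \<longleftrightarrow> card P + num_cycles (B \<union> C - {x, y}) (pair_perm P \<circ> skip y (skip x r)) = card (B \<union> C - {x, y})"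
    proof -
      have "finite P" using P finite by (auto intro: finite_pair_partition)
      moreover have "card (B \<union> C) = card (B \<union> C - {x, y}) + 2"
        using card_Diff_subset[of "{x, y}" "B \<union> C"] card_mono[of "B \<union> C" "{x, y}"] x y finite by simp
      ultimately show ?thesis
        using num_cycles_pair_perm_insert[OF perm finite(3) x(1) y_def[symmetric] y(4,5) P] Q by simp
    qed
    moreover have "(\<forall>u\<in>E. {u, r u} \<notin> insert {x, y} P)
      \<longleftrightarrow> (\<forall>u\<in>{u \<in> E. u \<noteq> y \<and> r u \<noteq> x}. {u, skip y (skip x r) u} \<notin> P)"
    proof -
      have "skip y (skip x r) u = r u" if "u \<in> E" "u \<noteq> y" "r u \<noteq> x" for u
        using skip_step_apply[OF x(1,2), of u] that x(3) by (auto simp: y_def)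
      \<comment> \<open>As \<open>x\<close> is not in \<open>E\<close>, equality would force
        \<open>u = y\<close> and \<open>r y = x\<close>, which is excluded.\<close>
      moreover have "{u, r u} \<noteq> {x, y}" if "u \<in> E" for u
        using that x y by (auto simp: doubleton_eq_iff)
      moreover have "{u, r u} \<notin> P" if "u = y \<or> r u = x" for u
        using that sub by auto
      ultimately have "{u, r u} \<in> insert {x, y} P \<longleftrightarrow> u \<noteq> y \<and> r u \<noteq> x \<and> {u, skip y (skip x r) u} \<in> P"
        if "u \<in> E" for u
        using that by (cases "u = y \<or> r u = x") auto
      then show ?thesis by blast
    qed
    ultimately show ?thesis
      using P Q by (simp add: planar_pairings_def A flip: y_def)
  qed
  have "?L = insert {x, y} ` ?R"
  proof (intro equalityI subsetI)
    fix P assume P: "P \<in> ?L"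
    then have P': "insert {x, y} (P - {{x, y}}) = P" by (auto simp: y_def)
    then have "pair_partition_on (B \<union> C - {x, y}) (P - {{x, y}})"
      using P insert_iff[of "P - {{x, y}}"] by (auto simp: planar_pairings_def)
    then have "P - {{x, y}} \<in> ?R"
      using iff[of "P - {{x, y}}"] P unfolding P' by blast
    then show "P \<in> insert {x, y} ` ?R"
      by (rule image_eqI[rotated]) (rule P'[symmetric])
  next
    fix P assume "P \<in> insert {x, y} ` ?R"
    then obtain Q where Q: "Q \<in> ?R" "P = insert {x, y} Q" by blast
    then have "pair_partition_on (B \<union> C - {x, y}) Q"
      by (simp add: planar_pairings_def A flip: y_def)
    then show "P \<in> ?L" unfolding Q(2) using iff Q(1) by blast
  qed
  moreover have "inj_on (insert {x, y}) ?R"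
  proof (rule inj_onI)
    fix P Q assume PQ: "P \<in> ?R" "Q \<in> ?R" and eq: "insert {x, y} P = insert {x, y} Q"
    have "{x, y} \<notin> P" "{x, y} \<notin> Q"
      using insert_iff[of P] insert_iff[of Q] PQ by (simp_all add: planar_pairings_def A flip: y_def)
    then show "P = Q" using eq by (metis insert_ident)
  qed
  ultimately show ?thesis by (simp add: card_image)
qed

text \<open>The circle of \<open>x\<close> loses two points and one opener, so its number of through
  strings does not change.\<close>

lemma weight_remove:
  assumes x: "x \<in> B \<union> C" "r x \<noteq> x" and S: "S \<subseteq> B \<union> C - {x, r x}"
  shows "weight B C (insert x S) = weight (B - {x, r x}) (C - {x, r x}) S"
proof -
  have D: "card D = card (D - {x, r x}) + 2 \<and> card (insert x S \<inter> D) = card (S \<inter> (D - {x, r x})) + 1"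
    if "x \<in> D" "r x \<in> D" "finite D" for D
  proof -
    have "card {x, r x} \<le> card D" using that by (intro card_mono) auto
    then have "card D = card (D - {x, r x}) + 2"
      using that x card_Diff_subset[of "{x, r x}" D] by simp
    moreover have "insert x S \<inter> D = insert x (S \<inter> (D - {x, r x}))" "x \<notin> S"
      using that S by auto
    moreover have "finite (S \<inter> (D - {x, r x}))" using that by simp
    ultimately show ?thesis by simp
  qed
  consider "x \<in> B" "r x \<in> B" "x \<notin> C" "r x \<notin> C" | "x \<in> C" "r x \<in> C" "x \<notin> B" "r x \<notin> B"
    using x disj step_in[of x] by blast
  then show ?thesis
  proof cases
    case 1
    then have "C - {x, r x} = C" "insert x S \<inter> C = S \<inter> C" by auto
    then show ?thesis
      using D[of B] 1 finite unfolding weight_def by simp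
  next
    case 2
    then have "B - {x, r x} = B" "insert x S \<inter> B = S \<inter> B" by auto
    then show ?thesis
      using D[of C] 2 finite unfolding weight_def by simp
  qed
qed

text \<open>Removing \<open>x\<close> from \<open>S\<close> is a bijection. The constraints that
  drop out hold automatically: at the preimage of \<open>x\<close> because \<open>x\<close> is in
  \<open>S\<close>, and at \<open>r x\<close> because \<open>r x\<close> is not.\<close>

lemma opener_sets_remove:
  assumes x: "x \<in> B \<union> C" "r x \<noteq> x" "x \<notin> E"
    and ne: "B - {x, r x} \<noteq> {}" "C - {x, r x} \<noteq> {}"
  shows "sum (weight B C) {S \<in> opener_sets B C r E. x \<in> S \<and> r x \<notin> S}
    = sum (weight (B - {x, r x}) (C - {x, r x}))
        (opener_sets (B - {x, r x}) (C - {x, r x}) (skip (r x) (skip x r))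
          {u \<in> E. u \<noteq> r x \<and> r u \<noteq> x})"
    (is "sum _ ?L = sum _ ?R")
proof -
  have A: "B - {x, r x} \<union> (C - {x, r x}) = B \<union> C - {x, r x}" by blast
  have rr: "r (r x) \<noteq> x" using step_twice[OF x(1) ne] .
  have iff: "insert x S \<in> ?L \<longleftrightarrow> S \<in> ?R" if S: "S \<subseteq> B \<union> C - {x, r x}" for S
  proof -
    have skip: "skip (r x) (skip x r) u = r u" if "u \<in> E" "u \<noteq> r x" "r u \<noteq> x" for u
      using skip_step_apply[OF x(1,2), of u] that x(3) by auto
    have "(\<forall>u\<in>E. u \<in> insert x S \<longrightarrow> r u \<in> insert x S)
      \<longleftrightarrow> (\<forall>u\<in>{u \<in> E. u \<noteq> r x \<and> r u \<noteq> x}. u \<in> S \<longrightarrow> skip (r x) (skip x r) u \<in> S)"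
      using S x(3) skip by (smt (verit) insert_Diff1 insert_iff mem_Collect_eq subset_Diff_insert)
    then show ?thesis
      using S x by (auto simp: opener_sets_def A)
  qed
  show ?thesis
  proof (rule sum.reindex_bij_witness[of _ "insert x" "\<lambda>S. S - {x}"])
    fix S assume S: "S \<in> ?L"
    then have S': "insert x (S - {x}) = S" "S - {x} \<subseteq> B \<union> C - {x, r x}"
      by (auto simp: opener_sets_def)
    then show "insert x (S - {x}) = S" "S - {x} \<in> ?R"
      using iff[of "S - {x}"] S by auto
    show "weight (B - {x, r x}) (C - {x, r x}) (S - {x}) = weight B C S"
      using weight_remove[OF x(1,2) S'(2)] S'(1) by simp
  next
    fix S assume S: "S \<in> ?R"
    then have "S \<subseteq> B \<union> C - {x, r x}" by (simp add: opener_sets_def A)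
    then show "insert x S - {x} = S" "insert x S \<in> ?L"
      using iff[of S] S by auto
  qed
qed

end

section \<open>No adjacent pairs, and the induction\<close>

lemma cyclic_on_funpow_bij:
  assumes "cyclic_on f S" "x \<in> S"
  shows "bij_betw (\<lambda>k. (f ^^ k) x) {..<card S} S" "(f ^^ card S) x = x"
proof -
  have S: "orbit f x = S" using assms by (rule orbit_cyclic_eq3)
  then have x: "x \<in> orbit f x" using assms by simp
  then have "bij_betw (\<lambda>k. (f ^^ k) x) {..<funpow_dist1 f x x} S"
    using inj_on_funpow_dist1[OF x] orbit_conv_funpow_dist1[OF x] S
    by (simp add: bij_betw_def atLeast0LessThan)
  moreover from this have "card S = funpow_dist1 f x x"
    using bij_betw_same_card by fastforce
  ultimately show "bij_betw (\<lambda>k. (f ^^ k) x) {..<card S} S" "(f ^^ card S) x = x"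
    using funpow_dist1_prop[OF x] by auto
qed

text \<open>The map sends the \<open>k\<close>-th iterate of \<open>x\<close> under \<open>f\<close>
  to the \<open>k\<close>-th iterate of \<open>y\<close> under \<open>g\<close>.\<close>

lemma cyclic_on_conjugate:
  assumes f: "cyclic_on f S" "x \<in> S" and g: "cyclic_on g T" "y \<in> T" and card: "card S = card T"
  obtains h where "bij_betw h S T" "h x = y" "\<And>u. u \<in> S \<Longrightarrow> h (f u) = g (h u)"
proof -
  define n where "n = card S"
  define e where "e = (\<lambda>k. (f ^^ k) x)"
  define e' where "e' = (\<lambda>k. (g ^^ k) y)"
  define h where "h = e' \<circ> inv_into {..<n} e"
  have e: "bij_betw e {..<n} S" "e n = x" and e': "bij_betw e' {..<n} T" "e' n = y"
    using cyclic_on_funpow_bij[OF f] cyclic_on_funpow_bij[OF g] card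
    by (simp_all add: e_def e'_def n_def)
  have n: "n > 0" using f finite_cyclic_on by (auto simp: n_def card_gt_0_iff)
  have he: "h (e k) = e' k" if "k < n" for k
    using that e by (simp add: h_def bij_betw_inv_into_left)
  \<comment> \<open>The inverse of \<open>e\<close> only covers exponents below \<open>n\<close>; at
    \<open>Suc k = n\<close> both cycles have returned to their starting points.\<close>
  have he_Suc: "h (e (Suc k)) = e' (Suc k)" if "k < n" for k
  proof (cases "Suc k = n")
    case True
    have "h (e 0) = e' 0" using he n by blast
    then have "h x = y" by (simp add: e_def e'_def)
    then show ?thesis using True e e' by simp
  qed (use he that in auto)
  show ?thesis
  proof
    show "bij_betw h S T"
      unfolding h_def using e e' bij_betw_inv_into bij_betw_trans by blast
    have "h (e 0) = e' 0" using he n by blast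
    then show "h x = y" by (simp add: e_def e'_def)
    fix u assume "u \<in> S"
    then obtain k where k: "k < n" "u = e k"
      using e by (auto simp: bij_betw_def)
    then show "h (f u) = g (h u)"
      using he[OF k(1)] he_Suc[OF k(1)] by (simp add: e_def e'_def)
  qed
qed

context two_cycles
begin

lemma cycle_induct:
  assumes "u \<in> B" "b \<in> B" "Q b" "\<And>v. v \<in> B \<Longrightarrow> Q v \<Longrightarrow> Q (r v)"
  shows "Q u"
proof -
  have "u \<in> orbit r b" using assms(1,2) orbit_cyclic_eq3[OF cyclic(1)] by blast
  then have "u \<in> B \<and> Q u"
    by induction (use assms step_in in auto)
  then show ?thesis ..
qed

text \<open>Without adjacent pairs \<open>pair_perm P \<circ> r\<close> has no fixed points, and
  \<open>card P\<close> is half the number of points. Genus zero then means that the composition is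
  an involution, that is, that \<open>pair_perm P\<close> conjugates \<open>r\<close> to its
  inverse.\<close>

lemma genus_no_adjacent:
  assumes P: "pair_partition_on (B \<union> C) P" and E: "\<forall>x\<in>B \<union> C. {x, r x} \<notin> P"
  shows "card P + num_cycles (B \<union> C) (pair_perm P \<circ> r) = card (B \<union> C)
    \<longleftrightarrow> (\<forall>u\<in>B \<union> C. r (pair_perm P (r u)) = pair_perm P u)"
proof -
  have "pair_perm P (r u) \<noteq> u" if "u \<in> B \<union> C" for u
    using that E pair_block_iff[OF P, of u "r u"] pair_perm_involution[OF P] by metis
  moreover have "pair_perm P (r (pair_perm P (r u))) = u \<longleftrightarrow> r (pair_perm P (r u)) = pair_perm P u" for u
    using pair_perm_involution[OF P] by metis
  ultimately have "2 * num_cycles (B \<union> C) (pair_perm P \<circ> r) = card (B \<union> C)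
      \<longleftrightarrow> (\<forall>u\<in>B \<union> C. r (pair_perm P (r u)) = pair_perm P u)"
    using num_cycles_no_fixed_points[OF permutes_compose[OF perm pair_perm_permutes[OF P]] finite(3)]
    by simp
  then show ?thesis using card_pair_partition[OF P finite(3)] by linarith
qed

text \<open>From \<open>r (f (r v)) = f v\<close> it follows that \<open>f (r v)\<close> and
  \<open>f v\<close> lie on the same circle, so one crossing spreads along all of
  \<open>B\<close>.\<close>

lemma reflection_maps_cycle:
  assumes refl: "\<forall>u\<in>B \<union> C. r (f (r u)) = f u" and i: "i \<in> B" "f i \<in> C" and u: "u \<in> B"
  shows "f u \<in> C"
  using u i(1) i(2)
proof (rule cycle_induct)
  fix v assume "v \<in> B" "f v \<in> C"
  then show "f (r v) \<in> C" using refl step_in(2)[of "f (r v)"] by simp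
qed

lemma planar_pairings_no_adjacent:
  assumes E: "B \<union> C \<subseteq> E" and P: "P \<in> planar_pairings B C r E"
  shows "pair_partition_on (B \<union> C) P" "\<forall>u\<in>B \<union> C. r (pair_perm P (r u)) = pair_perm P u"
    "u \<in> B \<Longrightarrow> pair_perm P u \<in> C" "u \<in> C \<Longrightarrow> pair_perm P u \<in> B"
proof -
  show pp: "pair_partition_on (B \<union> C) P"
    using P by (simp add: planar_pairings_def)
  show refl: "\<forall>u\<in>B \<union> C. r (pair_perm P (r u)) = pair_perm P u"
    using genus_no_adjacent[OF pp] P E by (auto simp: planar_pairings_def)
  obtain i j where "i \<in> B" "j \<in> C" "{i, j} \<in> P"
    using P by (auto simp: planar_pairings_def)
  then have ij: "i \<in> B" "pair_perm P i \<in> C" "j \<in> C" "pair_perm P j \<in> B"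
    using pair_block_iff[OF pp, of i j] pair_block_iff[OF pp, of j i] by (auto simp: insert_commute)
  show "u \<in> B \<Longrightarrow> pair_perm P u \<in> C"
    using reflection_maps_cycle[OF refl] ij by blast
  show "u \<in> C \<Longrightarrow> pair_perm P u \<in> B"
    using two_cycles.reflection_maps_cycle[OF swap, of "pair_perm P" j u] refl ij by blast
qed

text \<open>The pairs are \<open>{u, h u}\<close>, where \<open>h\<close> maps \<open>B\<close> onto
  \<open>C\<close>, takes \<open>b\<close> to \<open>c\<close> and reverses the direction of
  \<open>r\<close>.\<close>

lemma ex_planar_pairing_no_adjacent:
  assumes card: "card B = card C" and b: "b \<in> B" and c: "c \<in> C"
  shows "\<exists>P\<in>planar_pairings B C r E. pair_perm P b = c"
proof -
  have perm': "permutation r" using perm finite permutation_permutes by blast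
  have inv: "inv r (r u) = u" "r (inv r u) = u" for u
    using perm by (simp_all add: permutes_inverses)
  have "cyclic_on (inv r) C"
    using cyclic(2) orbit_inv_eq[OF perm'] by (simp add: cyclic_on_def)
  then obtain h where h: "bij_betw h B C" "h b = c" "\<And>u. u \<in> B \<Longrightarrow> h (r u) = inv r (h u)"
    using cyclic_on_conjugate[OF cyclic(1) b _ c card] by blast
  have hC: "h u \<in> C" if "u \<in> B" for u
    using that h by (auto simp: bij_betw_def)
  have hinj: "h u = h v \<longleftrightarrow> u = v" if "u \<in> B" "v \<in> B" for u v
    using that h by (auto simp: bij_betw_def inj_on_def)
  define P where "P = (\<lambda>u. {u, h u}) ` B"
  have pp: "pair_partition_on (B \<union> C) P"
    unfolding pair_partition_on_def partition_on_def
  proof (intro conjI ballI)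
    show "\<Union>P = B \<union> C"
      using h(1) by (auto simp: P_def bij_betw_def)
    have "{u, h u} \<inter> {v, h v} = {}" if "u \<in> B" "v \<in> B" "u \<noteq> v" for u v
      using that hC hinj disj by auto
    then show "disjoint P"
      unfolding P_def by (intro disjointI) (elim imageE, metis)
    show "{} \<notin> P" by (auto simp: P_def)
    fix Q assume "Q \<in> P"
    then obtain u where u: "u \<in> B" "Q = {u, h u}" unfolding P_def by blast
    have "h u \<noteq> u" using hC[OF u(1)] u(1) disj by auto
    then show "card Q = 2" using u(2) by simp
  qed
  have PB: "pair_perm P u = h u" and PC: "pair_perm P (h u) = u" if "u \<in> B" for u
    using that pair_block_iff[OF pp, of u "h u"] pair_block_iff[OF pp, of "h u" u]
    by (auto simp: P_def insert_commute)
  have no_adj: "{x, r x} \<notin> P" for x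
  proof
    assume x: "{x, r x} \<in> P"
    then have A: "x \<in> B \<union> C" and eq: "pair_perm P x = r x"
      using pair_block_iff[OF pp] by auto
    show False
    proof (cases "x \<in> B")
      case True
      then show ?thesis using PB[OF True] hC[OF True] eq step_in[of x] disj by auto
    next
      case False
      then obtain v where "v \<in> B" "x = h v" using A h(1) by (auto simp: bij_betw_def)
      then show ?thesis using PC[of v] eq step_in[of x] False by auto
    qed
  qed
  have "r (pair_perm P (r u)) = pair_perm P u" if u: "u \<in> B \<union> C" for u
  proof (cases "u \<in> B")
    case True
    then show ?thesis using PB step_in h(3) inv by simp
  next
    case False
    then obtain v where v: "v \<in> B" "u = h v" using u h(1) by (auto simp: bij_betw_def)
    \<comment> \<open>The identity for \<open>h\<close> speaks of \<open>h (r w)\<close>, so a point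
      of \<open>C\<close> is handled by stepping back from its partner in \<open>B\<close>.\<close>
    obtain w where w: "w \<in> B" "v = r w"
      using v step_in[of "inv r v"] inv by metis
    then have "u = inv r (h w)" using v h(3) by simp
    then have "r u = h w" using inv by simp
    then show ?thesis using PC v w by simp
  qed
  then have "card P + num_cycles (B \<union> C) (pair_perm P \<circ> r) = card (B \<union> C)"
    using genus_no_adjacent[OF pp] no_adj by blast
  moreover have "{b, c} \<in> P" using b h(2) by (auto simp: P_def)
  ultimately have "P \<in> planar_pairings B C r E"
    using pp no_adj b c by (auto simp: planar_pairings_def)
  then show ?thesis using PB[OF b] h(2) by blast
qed

text \<open>The partner of a single point \<open>b\<close> determines the pairing: the reflection
  identity carries it along \<open>B\<close>, and the involution fixes the rest. Every point of
  \<open>C\<close> occurs as partner. For circles of different size, a bijection between them would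
  be needed.\<close>

lemma card_planar_pairings_no_adjacent:
  assumes E: "B \<union> C \<subseteq> E"
  shows "card (planar_pairings B C r E) = (if card B = card C then card B else 0)"
proof (cases "card B = card C")
  case True
  obtain b where b: "b \<in> B" using nonempty by blast
  have "bij_betw (\<lambda>P. pair_perm P b) (planar_pairings B C r E) C"
  proof (rule bij_betw_imageI)
    show "inj_on (\<lambda>P. pair_perm P b) (planar_pairings B C r E)"
    proof (rule inj_onI)
      fix P Q
      assume PQ: "P \<in> planar_pairings B C r E" "Q \<in> planar_pairings B C r E"
        and b_eq: "pair_perm P b = pair_perm Q b"
      note P = planar_pairings_no_adjacent[OF E PQ(1)] and Q = planar_pairings_no_adjacent[OF E PQ(2)]
      have B: "pair_perm P u = pair_perm Q u" if "u \<in> B" for u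
        using that b b_eq
      proof (rule cycle_induct)
        fix v assume v: "v \<in> B" "pair_perm P v = pair_perm Q v"
        then have "r (pair_perm P (r v)) = r (pair_perm Q (r v))"
          using P(2) Q(2) by simp
        then show "pair_perm P (r v) = pair_perm Q (r v)" using inj by (metis injD)
      qed
      show "P = Q"
      proof (rule pair_partition_eqI[OF P(1) Q(1)])
        fix u assume u: "u \<in> B \<union> C"
        show "pair_perm P u = pair_perm Q u"
        proof (cases "u \<in> B")
          case False
          then have "pair_perm P u \<in> B" using P(4) u by blast
          then have "pair_perm Q (pair_perm P u) = u"
            using B pair_perm_involution[OF P(1)] by metis
          then show ?thesis using pair_perm_involution[OF Q(1)] by metis
        qed (rule B)
      qed
    qed
    show "(\<lambda>P. pair_perm P b) ` planar_pairings B C r E = C"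
      using planar_pairings_no_adjacent(3)[OF E] b ex_planar_pairing_no_adjacent[OF True b]
      by blast
  qed
  then show ?thesis using True by (simp add: bij_betw_same_card)
next
  case False
  have "planar_pairings B C r E = {}"
  proof (rule ccontr)
    assume "planar_pairings B C r E \<noteq> {}"
    then obtain P where "P \<in> planar_pairings B C r E" by blast
    note P = planar_pairings_no_adjacent[OF E this]
    have inj: "inj_on (pair_perm P) D" for D
      using permutes_inj[OF pair_perm_permutes[OF P(1)]] by (rule inj_on_subset) simp
    have "card B = card C"
      using card_inj_on_le[OF inj _ finite(2), of B] card_inj_on_le[OF inj _ finite(1), of C] P(3,4)
      by (intro antisym) auto
    then show False using False by simp
  qed
  then show ?thesis using False by simp
qed

text \<open>A nonempty \<open>S\<close> closed under \<open>r\<close> contains a whole circle and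
  has weight 0, by truncated subtraction; only the empty set contributes.\<close>

lemma sum_opener_sets_no_adjacent:
  assumes E: "B \<union> C \<subseteq> E"
  shows "sum (weight B C) (opener_sets B C r E) = (if card B = card C then card B else 0)"
proof -
  have "weight B C S = 0" if S: "S \<in> opener_sets B C r E" "S \<noteq> {}" for S
  proof -
    have closed: "r u \<in> S" if "u \<in> S" for u
      using that S E by (auto simp: opener_sets_def)
    have "B \<subseteq> S" if "u \<in> S" "u \<in> B" for u
      using cycle_induct[of _ u "\<lambda>v. v \<in> S"] closed that by blast
    moreover have "C \<subseteq> S" if "u \<in> S" "u \<in> C" for u
      using two_cycles.cycle_induct[OF swap, of _ u "\<lambda>v. v \<in> S"] closed that by blast
    moreover have "S \<subseteq> B \<union> C" using S by (simp add: opener_sets_def)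
    ultimately have "S \<inter> B = B \<or> S \<inter> C = C" using S(2) by blast
    then show ?thesis by (auto simp: weight_def)
  qed
  moreover have "{} \<in> opener_sets B C r E" by (simp add: opener_sets_def)
  ultimately have "sum (weight B C) (opener_sets B C r E) = sum (weight B C) {{}}"
    using finite_opener_sets by (intro sum.mono_neutral_right) auto
  then show ?thesis by (simp add: weight_def)
qed

end

lemma card_planar_pairings:
  assumes "two_cycles B C r"
  shows "card (planar_pairings B C r E) = sum (weight B C) (opener_sets B C r E)"
  using assms
\<comment> \<open>The measure counts the points plus those not yet in \<open>E\<close>: forbidding a
  point lowers the second summand, deleting a pair lowers the first.\<close>
proof (induction "card (B \<union> C) + card (B \<union> C - E)" arbitrary: B C r E rule: less_induct)
  case less
  interpret two_cycles B C r by fact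
  show ?case
  proof (cases "B \<union> C \<subseteq> E")
    case True
    then show ?thesis
      by (simp add: card_planar_pairings_no_adjacent sum_opener_sets_no_adjacent)
  next
    case False
    then obtain x where x: "x \<in> B \<union> C" "x \<notin> E" by blast
    have "card (B \<union> C - insert x E) < card (B \<union> C - E)"
      using x finite by (intro psubset_card_mono) auto
    then have IH: "card (planar_pairings B C r (insert x E))
        = sum (weight B C) (opener_sets B C r (insert x E))"
      by (intro less.hyps two_cycles_axioms) simp
    have "card {P \<in> planar_pairings B C r E. {x, r x} \<in> P}
        = sum (weight B C) {S \<in> opener_sets B C r E. x \<in> S \<and> r x \<notin> S}"
    proof (cases "r x = x \<or> B - {x, r x} = {} \<or> C - {x, r x} = {}")
      case True
      then show ?thesis
        unfolding planar_pairings_degenerate[OF x(1) True] opener_sets_degenerate[OF x(1) True] by simp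
    next
      case False
      define B' C' E' where "B' = B - {x, r x}" and "C' = C - {x, r x}"
        and "E' = {u \<in> E. u \<noteq> r x \<and> r u \<noteq> x}"
      have A: "B' \<union> C' = B \<union> C - {x, r x}" by (auto simp: B'_def C'_def)
      have "card (B' \<union> C') < card (B \<union> C)"
        unfolding A using x finite by (intro psubset_card_mono) auto
      moreover have "card (B' \<union> C' - E') \<le> card (B \<union> C - E)"
      proof (rule card_inj_on_le)
        \<comment> \<open>Deleting the pair can free one point, the preimage of \<open>x\<close>,
          from \<open>E\<close>. It is charged to \<open>x\<close>, which was outside
          \<open>E\<close> and is now gone, so the second summand does not grow.\<close>
        show "inj_on (\<lambda>u. if u \<in> E then x else u) (B' \<union> C' - E')"
          using inj by (intro inj_onI) (auto simp: A E'_def split: if_splits dest: injD)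
        show "(\<lambda>u. if u \<in> E then x else u) ` (B' \<union> C' - E') \<subseteq> B \<union> C - E"
          using x by (auto simp: A)
      qed (use finite in simp)
      ultimately have "card (planar_pairings B' C' (skip (r x) (skip x r)) E')
          = sum (weight B' C') (opener_sets B' C' (skip (r x) (skip x r)) E')"
        using skip_step[OF x(1)] False by (intro less.hyps) (auto simp: B'_def C'_def)
      then show ?thesis
        using planar_pairings_remove[OF x(1) _ x(2)] opener_sets_remove[OF x(1) _ x(2)] False
        by (simp add: B'_def C'_def E'_def)
    qed
    then show ?thesis
      using planar_pairings_split[of E x] opener_sets_split[of E x] IH by simp
  qed
qed

section \<open>The annular permutation\<close>

text \<open>The \<open>n\<close>-th power rotates the list by \<open>n\<close> places, so the orbit
  of the first entry runs through all entries.\<close>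

lemma cyclic_on_cycle_of_list:
  assumes "cycle cs" "cs \<noteq> []"
  shows "cyclic_on (cycle_of_list cs) (set cs)"
proof -
  have "(cycle_of_list cs ^^ n) (cs ! 0) = cs ! (n mod length cs)" for n
  proof -
    have "map (cycle_of_list cs ^^ n) cs ! 0 = rotate n cs ! 0"
      using cyclic_rotation[OF assms(1)] by simp
    then show ?thesis using assms(2) by (simp add: nth_rotate)
  qed
  moreover have "{cs ! (n mod length cs) | n. True} = set cs"
    using assms(2) by (auto simp: set_conv_nth) (metis mod_less)
  moreover have "permutation (cycle_of_list cs)"
    using cycle_permutes permutation_permutes by blast
  ultimately have "orbit (cycle_of_list cs) (cs ! 0) = set cs"
    by (simp add: orbit_altdef_permutation)
  then show ?thesis using assms(2) by (intro cyclic_on_singleI[of "cs ! 0"]) auto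
qed

lemma two_cycles_annular_perm:
  assumes "p \<ge> 1" "q \<ge> 1"
  shows "two_cycles {1..p} {p+1..p+q} (annular_perm p q)"
proof
  have B: "set [1..<p+1] = {1..p}" and C: "set [p+1..<p+q+1] = {p+1..p+q}" by auto
  have perm: "cycle_of_list [1..<p+1] permutes {1..p}" "cycle_of_list [p+1..<p+q+1] permutes {p+1..p+q}"
    using cycle_permutes[of "[1..<p+1]"] cycle_permutes[of "[p+1..<p+q+1]"] unfolding B C by blast+
  show disj: "{1..p} \<inter> {p+1..p+q} = {}" by auto
  show "annular_perm p q permutes {1..p} \<union> {p+1..p+q}"
    unfolding annular_perm_def using perm
    by (intro permutes_compose) (auto intro: permutes_subset)
  have cyc: "cyclic_on (cycle_of_list [1..<p+1]) {1..p}" "cyclic_on (cycle_of_list [p+1..<p+q+1]) {p+1..p+q}"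
    using cyclic_on_cycle_of_list[of "[1..<p+1]"] cyclic_on_cycle_of_list[of "[p+1..<p+q+1]"] assms
    unfolding B C by simp_all
  show "cyclic_on (annular_perm p q) {1..p}"
    unfolding annular_perm_def
    by (rule permutes_comp_preserves_cyclic1[OF perm(2) cyc(1) disj order_refl])
  show "cyclic_on (annular_perm p q) {p+1..p+q}"
    unfolding annular_perm_def
    by (rule permutes_comp_preserves_cyclic2[OF perm(1) cyc(2) disj order_refl])
qed

text \<open>The cycles of \<open>pair_perm P\<close> are the pairs, and as an involution it is its
  own inverse; no adjacent pair is forbidden yet.\<close>

lemma NC2_eq_planar_pairings: "NC2 p q = planar_pairings {1..p} {p+1..p+q} (annular_perm p q) {}"
proof -
  have "{1..p} \<union> {p+1..p+q} = {1..p+q}" by auto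
  moreover have "num_cycles A (pair_perm P) = card P" "inv (pair_perm P) = pair_perm P"
    if "pair_partition_on A P" for A and P :: "nat set set"
    using that by (simp_all add: num_cycles_def cycles_pair_perm inv_pair_perm)
  ultimately show ?thesis
    unfolding NC2_def planar_pairings_def by auto
qed

section \<open>Summing the weights of all subsets\<close>

lemma binom_eq_card_subsets:
  fixes B :: "'a set"
  assumes "finite B" "a \<le> card B"
  shows "binom (card B) ((real (card B) - real a) / 2) = card {S. S \<subseteq> B \<and> 2 * card S + a = card B}"
proof (cases "even (card B - a)")
  case True
  then obtain k where "card B - a = 2 * k" by blast
  then have k: "card B = 2 * k + a" using assms(2) by linarith
  then have "(real (card B) - real a) / 2 = real k" by simp
  then have "binom (card B) ((real (card B) - real a) / 2) = card B choose k"
    by (simp add: binom_def)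
  moreover have "{S. S \<subseteq> B \<and> 2 * card S + a = card B} = {S. S \<subseteq> B \<and> card S = k}"
    using k by auto
  ultimately show ?thesis using n_subsets[OF assms(1)] by simp
next
  case False
  \<comment> \<open>For the wrong parity both sides vanish: the binomial by its convention, the set
    because no cardinality solves the equation.\<close>
  have "(real (card B) - real a) / 2 \<notin> \<nat>"
  proof
    assume "(real (card B) - real a) / 2 \<in> \<nat>"
    then obtain k where "(real (card B) - real a) / 2 = real k" by (rule Nats_cases)
    then have "real (card B) = real (2 * k + a)" by (simp add: field_simps)
    then have "card B = 2 * k + a" by (simp only: of_nat_eq_iff)
    then show False using False by simp
  qed
  moreover have "2 * card S + a \<noteq> card B" for S :: "'a set"
  proof
    assume "2 * card S + a = card B"
    then have "card B - a = 2 * card S" by simp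
    then show False using False by simp
  qed
  ultimately show ?thesis by (simp add: binom_def)
qed

text \<open>The subsets are grouped by the common number \<open>a\<close> of through strings; for
  fixed \<open>a\<close> the openers on the two circles are chosen independently.\<close>

lemma sum_weight:
  assumes fin: "finite B" "finite C" and disj: "B \<inter> C = {}"
  shows "sum (weight B C) (Pow (B \<union> C)) =
    (\<Sum>a=1..min (card B) (card C). a * binom (card B) ((real (card B) - real a) / 2)
      * binom (card C) ((real (card C) - real a) / 2))"
proof -
  define X where "X = (\<lambda>a (D :: 'a set). {S. S \<subseteq> D \<and> 2 * card S + a = card D})"
  define I where "I = {1..min (card B) (card C)}"
  define T where "T = (\<lambda>a. {S \<in> Pow (B \<union> C). S \<inter> B \<in> X a B \<and> S \<inter> C \<in> X a C})"
  \<comment> \<open>A set of positive weight lies in \<open>T a\<close> for exactly one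
    \<open>a\<close>, its weight. Unequal numbers of through strings, or too many openers, give
    weight 0 and no such \<open>a\<close> in \<open>I\<close>.\<close>
  have weight: "weight B C S = (\<Sum>a\<in>I. if S \<in> T a then a else 0)" if S: "S \<in> Pow (B \<union> C)" for S
  proof (cases "weight B C S = 0")
    case True
    have "S \<notin> T a" if "a \<in> I" for a
      using that True by (auto simp: T_def X_def I_def weight_def split: if_splits)
    then show ?thesis using True by simp
  next
    case False
    define w where "w = weight B C S"
    have w: "w \<in> I" "\<And>a. S \<in> T a \<longleftrightarrow> a = w"
      using False S by (auto simp: w_def T_def X_def I_def weight_def split: if_splits)
    have "(\<Sum>a\<in>I. if S \<in> T a then a else 0) = (\<Sum>a\<in>I. if a = w then a else 0)"
      unfolding w(2) ..
    also have "\<dots> = w" using w(1) by (simp add: I_def)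
    finally show ?thesis by (simp add: w_def)
  qed
  have card_T: "card (T a) = card (X a B) * card (X a C)" for a
  proof -
    have "bij_betw (\<lambda>S. (S \<inter> B, S \<inter> C)) (T a) (X a B \<times> X a C)"
    proof (rule bij_betw_byWitness[where f' = "\<lambda>(U, V). U \<union> V"])
      have "(U \<union> V) \<inter> B = U" "(U \<union> V) \<inter> C = V" if "U \<in> X a B" "V \<in> X a C" for U V
        using that disj by (auto simp: X_def)
      then show "\<forall>UV\<in>X a B \<times> X a C. (\<lambda>S. (S \<inter> B, S \<inter> C)) ((\<lambda>(U, V). U \<union> V) UV) = UV"
        and "(\<lambda>(U, V). U \<union> V) ` (X a B \<times> X a C) \<subseteq> T a"
        by (auto simp: T_def) (auto simp: X_def)
    qed (auto simp: T_def)
    then show ?thesis by (simp add: bij_betw_same_card card_cartesian_product)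
  qed
  have "sum (weight B C) (Pow (B \<union> C)) = (\<Sum>S\<in>Pow (B \<union> C). \<Sum>a\<in>I. if S \<in> T a then a else 0)"
    by (rule sum.cong[OF refl weight])
  also have "\<dots> = (\<Sum>a\<in>I. \<Sum>S\<in>Pow (B \<union> C). if S \<in> T a then a else 0)"
    by (rule sum.swap)
  also have "\<dots> = (\<Sum>a\<in>I. a * card (T a))"
  proof (rule sum.cong[OF refl])
    fix a
    have "(\<Sum>S\<in>Pow (B \<union> C). if S \<in> T a then a else 0) = (\<Sum>S\<in>T a. a)"
      using fin by (intro sum.mono_neutral_cong_right) (auto simp: T_def)
    then show "(\<Sum>S\<in>Pow (B \<union> C). if S \<in> T a then a else 0) = a * card (T a)" by simp
  qed
  also have "\<dots> = (\<Sum>a\<in>I. a * binom (card B) ((real (card B) - real a) / 2)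
      * binom (card C) ((real (card C) - real a) / 2))"
    using fin by (intro sum.cong[OF refl]) (simp add: card_T X_def I_def binom_eq_card_subsets)
  finally show ?thesis by (simp add: I_def)
qed

theorem corollary1p6:
  fixes p q :: nat
  assumes "p \<ge> 1" and "q \<ge> 1" and "even p \<longleftrightarrow> even q"
  shows "card (NC2 p q) =
    (\<Sum>a=1..min p q. a * binom p ((real p - real a) / 2) * binom q ((real q - real a) / 2))"
proof -
  have "card (NC2 p q) = sum (weight {1..p} {p+1..p+q})
      (opener_sets {1..p} {p+1..p+q} (annular_perm p q) {})"
    unfolding NC2_eq_planar_pairings
    using assms by (intro card_planar_pairings two_cycles_annular_perm)
  \<comment> \<open>With nothing forbidden, every subset may serve as the set of openers.\<close>
  also have "opener_sets {1..p} {p+1..p+q} (annular_perm p q) {} = Pow ({1..p} \<union> {p+1..p+q})"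
    by (auto simp: opener_sets_def)
  also have "sum (weight {1..p} {p+1..p+q}) \<dots> =
    (\<Sum>a=1..min p q. a * binom p ((real p - real a) / 2) * binom q ((real q - real a) / 2))"
    using sum_weight[of "{1..p}" "{p+1..p+q}"] by simp
  finally show ?thesis .
qed

end
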